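(* Let $t>0$, $s=\tfrac12+it$, and let $\omega$ be defined by $\omega^2=\pi s/(2i)$ with $\operatorname{Re}\omega>0$. For every integer $m\ge 1$, the correction term $T_m(\omega):=\sum_{r=0}^{m-1}(\pi i/4)^r B_r(\omega)$ (with $B_r(\omega)$ as defined in the context) has the form $$T_m(\omega)=\csc\omega\sum_{k=0}^{2m-2}\frac{D_k(m)}{\omega^k},$$ where the coefficients $D_k(m)\equiv D_k(m;\omega)$ are given by $$D_k(m)=\sum_{r=\lceil k/2\rceil}^{m-1}\left(\frac{\pi i}{4}\right)^r d_{r,k},$$ and, for $r\ge 0$ and $0\le k\le 2r$, $$d_{r,k}=\sum_{p=0}^{k}\frac{(-2)^{k-p}\,\alpha_{k-p,r}}{(2r-k+p)!}\,b_{p,\,2r-k+p},$$ with the constants $\alpha_{j,r}$ and the trigonometric coefficients $b_{p,q}=b_{p,q}(\omega)$ as defined in the context.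
   Context: Branch of $\omega$: $\omega=\pi\,(t/2\pi)^{1/2}\,(1-\tfrac{i}{2t})^{1/2}$ with principal square roots; in particular $\omega$ is not real, so $\sin\omega\ne0$. The constants $\alpha_{j,r}$ ($r\ge0$, $0\le j\le 2r$) are the coefficients of the polynomials $W_r(\mu)=\sum_{j=0}^{2r}\alpha_{j,r}\mu^j$ that occur in the uniform asymptotic expansion of the normalised incomplete gamma function $Q(a,z)=\Gamma(a,z)/\Gamma(a)$, $$Q(a,z)\sim\tfrac12\operatorname{erfc}(\eta\sqrt{a/2})+\frac{e^{-a\eta^2/2}}{\sqrt{2\pi a}}\sum_{k\ge0}c_k(\eta)a^{-k},\qquad c_k(\eta)=\frac{(-1)^kW_k(\mu)}{\mu^{2k+1}}-\frac{(-2)^k(\tfrac12)_k}{\eta^{2k+1}},$$ where $\lambda=z/a$, $\mu=\lambda-1$, $\tfrac12\eta^2=\lambda-1-\log\lambda$ (with $\eta\simeq\lambda-1$ near $\lambda=1$), and $(x)_k$ is the Pochhammer symbol. Explicitly, $W_0(\mu)=1$ and for $k\ge1$ $$W_k(\mu)=-\mu^{2k}(1+\mu)\frac{d}{d\mu}\!\left[\frac{W_{k-1}(\mu)}{\mu^{2k-1}}\right]+g_k\mu^{2k},$$ where $g_k$ are the Stirling coefficients defined by $\Gamma(a)\sim\sqrt{2\pi/a}\,(a/e)^a\sum_{k\ge0}g_ka^{-k}$ ($g_0=1$, $g_1=\tfrac1{12}$, $g_2=\tfrac1{288}$, $g_3=-\tfrac{139}{51840},\dots$). For example $\alpha_{0,0}=1$;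 $\alpha_{0,1}=1,\ \alpha_{1,1}=1,\ \alpha_{2,1}=\tfrac1{12}$; $\alpha_{0,2}=3,\ \alpha_{1,2}=5,\ \alpha_{2,2}=\tfrac{25}{12},\ \alpha_{3,2}=\tfrac1{12},\ \alpha_{4,2}=\tfrac1{288}$. For $k=1,2,\dots$ define $$S_k(\omega):=2^{k-1}\sum_{n=-\infty}^{\infty}\frac{(-1)^n\omega^k}{(\omega^2-(\pi n)^2)^k},$$ and for $r\ge0$ define $$B_r(\omega):=\sum_{k=0}^{2r}(-1)^k\alpha_{k,r}\,\frac{S_{2r+1-k}(\omega)}{(\omega/2)^k}.$$ The coefficients $b_{p,q}=b_{p,q}(\omega)$ ($0\le p\le q$) are the polynomials in $\cot\omega$ and $\csc\omega$ occurring in the expansion $$S_{q+1}(\omega)=\frac{\csc\omega}{q!}\sum_{p=0}^{q}\frac{b_{p,q}}{\omega^p},$$ which is generated by $S_1(\omega)=\csc\omega$ and $S_{k+1}(\omega)=\frac1\omega S_k(\omega)-\frac1k\frac{dS_k(\omega)}{d\omega}$ ($k\ge1$). Explicitly, $b_{0,0}=1$ and $$b_{p,q+1}=\cot\omega\; b_{p,q}-\frac{d}{d\omega}b_{p,q}+(p+q)\,b_{p-1,q}\qquad(0\le p\le q+1),$$ with $b_{p,q}=0$ if $p<0$ or $p>q$. For example $b_{0,1}=\cot\omega$, $b_{1,1}=1$, $b_{0,2}=\cot^2\omega+\csc^2\omega$, $b_{1,2}=3\cot\omega$, $b_{2,2}=3$. *)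

theory Defs
  imports "HOL-Analysis.Analysis" "HOL-Library.Landau_Symbols"
    "HOL-Computational_Algebra.Polynomial"
begin

definition csc :: "complex \<Rightarrow> complex" where
  "csc w = 1 / sin w"

text \<open>
  Stirling coefficients: \<open>\<Gamma>(a) \<sim> sqrt (2\<pi>/a) (a/e)\<^sup>a \<Sum>k g\<^sub>k a\<^sup>-\<^sup>k\<close> as \<open>a \<rightarrow> \<infinity>\<close>, an
  asymptotic expansion in the sense of Poincare.
\<close>

definition is_stirling_coeffs :: "(nat \<Rightarrow> real) \<Rightarrow> bool" where
  "is_stirling_coeffs g \<longleftrightarrow>
     (\<forall>N. (\<lambda>a::real. Gamma a / (sqrt (2 * pi / a) * (a / exp 1) powr a) - (\<Sum>k<N. g k / a ^ k))
            \<in> O(\<lambda>a. 1 / a ^ N))"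

definition stirling_coeff :: "nat \<Rightarrow> real" where
  "stirling_coeff = (THE g. is_stirling_coeffs g)"

lemma is_stirling_coeffs_unique:
  assumes g: "is_stirling_coeffs g" and h: "is_stirling_coeffs h"
  shows "g = h"
proof
  fix n show "g n = h n"
  proof (induction n rule: less_induct)
    case (less n)
    let ?f = "\<lambda>a::real. Gamma a / (sqrt (2 * pi / a) * (a / exp 1) powr a)"
    have "(\<lambda>a. (?f a - (\<Sum>k<Suc n. g k / a ^ k)) - (?f a - (\<Sum>k<Suc n. h k / a ^ k)))
            \<in> O(\<lambda>a. 1 / a ^ Suc n)"
      by (rule sum_in_bigo(2)[OF g[unfolded is_stirling_coeffs_def, rule_format, of "Suc n"]
            h[unfolded is_stirling_coeffs_def, rule_format, of "Suc n"]])
    also have "(\<lambda>a. (?f a - (\<Sum>k<Suc n. g k / a ^ k)) - (?f a - (\<Sum>k<Suc n. h k / a ^ k)))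
               = (\<lambda>a. (h n - g n) / a ^ n)"
      using less by (auto simp: fun_eq_iff diff_divide_distrib)
    finally have "(\<lambda>a::real. (h n - g n) / a ^ n) \<in> O(\<lambda>a. 1 / a ^ Suc n)" .
    then obtain c where c: "eventually (\<lambda>a::real. norm ((h n - g n) / a ^ n)
        \<le> c * norm (1 / a ^ Suc n)) at_top"
      by (auto elim: landau_o.bigE)
    have "eventually (\<lambda>a::real. \<bar>h n - g n\<bar> \<le> c / a) at_top"
      using c eventually_gt_at_top[of 0]
      by eventually_elim (auto simp: field_simps abs_mult)
    moreover have "((\<lambda>a::real. c / a) \<longlongrightarrow> 0) at_top"
      by (intro tendsto_divide_0[OF tendsto_const] filterlim_at_top_imp_at_infinity filterlim_ident)
    ultimately have "\<bar>h n - g n\<bar> \<le> 0"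
      by (intro tendsto_lowerbound[of "\<lambda>a::real. c / a"]) auto
    then show ?case by simp
  qed
qed

text \<open>
  The recursion below is \<open>W\<^sub>k = -\<mu>\<^sup>2\<^sup>k (1 + \<mu>) d/d\<mu> [W\<^sub>k\<^sub>-\<^sub>1 / \<mu>\<^sup>2\<^sup>k\<^sup>-\<^sup>1] + g\<^sub>k \<mu>\<^sup>2\<^sup>k\<close> with the
  differentiation carried out, so that it stays within polynomials; see \<open>poly_W_poly_Suc\<close>.
\<close>

fun W_poly :: "nat \<Rightarrow> real poly" where
  "W_poly 0 = 1"
| "W_poly (Suc k) =
     - ([:1, 1:] * ([:0, 1:] * pderiv (W_poly k) - smult (of_nat (2 * k + 1)) (W_poly k)))
     + monom (stirling_coeff (Suc k)) (2 * Suc k)"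

lemma poly_W_poly_Suc:
  assumes "\<mu> \<noteq> 0"
  shows "poly (W_poly (Suc k)) \<mu> =
           - (\<mu> ^ (2 * Suc k) * (1 + \<mu>) * deriv (\<lambda>x. poly (W_poly k) x / x ^ (2 * Suc k - 1)) \<mu>)
           + stirling_coeff (Suc k) * \<mu> ^ (2 * Suc k)"
proof -
  have "((\<lambda>x. poly (W_poly k) x / x ^ (2 * k + 1)) has_real_derivative
          (poly (pderiv (W_poly k)) \<mu> * \<mu> ^ (2 * k + 1)
            - poly (W_poly k) \<mu> * (real (2 * k + 1) * \<mu> ^ (2 * k)))
          / (\<mu> ^ (2 * k + 1) * \<mu> ^ (2 * k + 1))) (at \<mu>)"
    using DERIV_divide[OF poly_DERIV[of "W_poly k" \<mu>] DERIV_pow[of "2 * k + 1" \<mu>]] assms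
    by simp
  then have d: "deriv (\<lambda>x. poly (W_poly k) x / x ^ (2 * Suc k - 1)) \<mu> =
          (poly (pderiv (W_poly k)) \<mu> * \<mu> ^ (2 * k + 1)
            - poly (W_poly k) \<mu> * (real (2 * k + 1) * \<mu> ^ (2 * k)))
          / (\<mu> ^ (2 * k + 1) * \<mu> ^ (2 * k + 1))"
    by (simp add: DERIV_imp_deriv)
  have e: "\<mu> ^ (2 * Suc k) * ((P * \<mu> ^ (2 * k + 1) - Q * (c * \<mu> ^ (2 * k)))
            / (\<mu> ^ (2 * k + 1) * \<mu> ^ (2 * k + 1))) = \<mu> * P - c * Q" for P Q c :: real
    using assms by (simp add: field_simps)
  have "\<mu> ^ (2 * Suc k) * (1 + \<mu>) * deriv (\<lambda>x. poly (W_poly k) x / x ^ (2 * Suc k - 1)) \<mu>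
      = (1 + \<mu>) * (\<mu> * poly (pderiv (W_poly k)) \<mu> - real (2 * k + 1) * poly (W_poly k) \<mu>)"
    unfolding d by (subst e[symmetric]) (simp only: mult_ac)
  then show ?thesis
    by (simp only: W_poly.simps poly_add poly_minus poly_mult poly_diff poly_smult poly_monom
        poly_pCons poly_0) simp
qed

lemma degree_W_poly: "degree (W_poly k) \<le> 2 * k"
proof (induction k)
  case (Suc k)
  have "degree ([:0, 1:] * pderiv (W_poly k)) \<le> 2 * k + 1"
    by (rule order.trans[OF degree_mult_le]) (use Suc in \<open>simp add: degree_pderiv\<close>)
  moreover have "degree (smult (of_nat (2 * k + 1)) (W_poly k)) \<le> 2 * k + 1"
    using Suc by (intro order.trans[OF degree_smult_le]) simp
  ultimately have "degree ([:0, 1:] * pderiv (W_poly k) - smult (of_nat (2 * k + 1)) (W_poly k))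
      \<le> 2 * k + 1"
    by (rule degree_diff_le)
  then have "degree ([:1, 1:] * ([:0, 1:] * pderiv (W_poly k)
      - smult (of_nat (2 * k + 1)) (W_poly k))) \<le> 2 * Suc k"
    by (intro order.trans[OF degree_mult_le]) simp
  then show ?case
    unfolding W_poly.simps
    by (intro degree_add_le) (simp_all only: degree_minus degree_monom_le)
qed simp

definition alpha :: "nat \<Rightarrow> nat \<Rightarrow> real" where
  "alpha j r = coeff (W_poly r) j"

lemma W_poly_2:
  "W_poly 2 = [:3, 5, 2 + stirling_coeff 1, stirling_coeff 1, stirling_coeff 2:]"
  by (simp add: numeral_eq_Suc monom_Suc monom_0 pderiv_pCons one_pCons)

definition S_series :: "nat \<Rightarrow> complex \<Rightarrow> complex" where
  "S_series k w = 2 ^ (k - 1) *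
     (\<Sum>\<^sub>\<infinity>n::int. (-1) powi n * w ^ k / (w\<^sup>2 - (of_real pi * of_int n)\<^sup>2) ^ k)"

definition B_term :: "nat \<Rightarrow> complex \<Rightarrow> complex" where
  "B_term r w = (\<Sum>k=0..2*r. (-1) ^ k * of_real (alpha k r)
                                 * (S_series (2 * r + 1 - k) w / (w / 2) ^ k))"

fun b_trig :: "nat \<Rightarrow> nat \<Rightarrow> complex \<Rightarrow> complex" where
  "b_trig p 0 w = (if p = 0 then 1 else 0)"
| "b_trig p (Suc q) w =
     (if p \<le> Suc q
      then cot w * b_trig p q w - deriv (b_trig p q) w
           + (if p = 0 then 0 else of_nat (p + q) * b_trig (p - 1) q w)
      else 0)"

definition T_corr :: "nat \<Rightarrow> complex \<Rightarrow> complex" where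
  "T_corr m w = (\<Sum>r<m. (of_real pi * \<i> / 4) ^ r * B_term r w)"

definition d_coeff :: "nat \<Rightarrow> nat \<Rightarrow> complex \<Rightarrow> complex" where
  "d_coeff r k w = (\<Sum>p=0..k. (-2) ^ (k - p) * of_real (alpha (k - p) r) / fact (2 * r - k + p)
                          * b_trig p (2 * r - k + p) w)"

definition D_coeff :: "nat \<Rightarrow> nat \<Rightarrow> complex \<Rightarrow> complex" where
  "D_coeff k m w = (\<Sum>r\<in>{nat \<lceil>real k / 2\<rceil>..<m}. (of_real pi * \<i> / 4) ^ r * d_coeff r k w)"

end

theory Submission
  imports Defs "HOL-Complex_Analysis.Complex_Analysis"
begin

text \<open>
  Differentiating the series for \<open>S\<^sub>k\<close> term by term gives \<open>S\<^sub>k\<^sub>+\<^sub>1 = S\<^sub>k / w - S\<^sub>k' / k\<close>, and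
  \<open>S\<^sub>1 = csc w\<close> is the partial fraction expansion of the cosecant, which follows from the
  reflection formula of the Digamma function. By induction, \<open>S\<^sub>q\<^sub>+\<^sub>1\<close> is \<open>csc w / q!\<close> times
  \<open>\<Sum>p\<le>q. b\<^sub>p\<^sub>,\<^sub>q / w\<^sup>p\<close>; collecting powers of \<open>1 / w\<close> in \<open>B\<^sub>r\<close> and then in \<open>T\<^sub>m\<close> gives the
  coefficients \<open>d\<^sub>r\<^sub>,\<^sub>k\<close> and \<open>D\<^sub>k(m)\<close>. Moreover \<open>sin w \<noteq> 0\<close>, because \<open>w\<^sup>2\<close> is not real.
\<close>

section \<open>Poles, even sums over the integers, and bounds on the summands\<close>

lemma open_sin_nonzero: "open {w::complex. sin w \<noteq> 0}"
  by (intro open_Collect_neq continuous_intros)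

lemma square_neq_pole:
  assumes "sin w \<noteq> (0::complex)"
  shows "w\<^sup>2 \<noteq> (of_real pi * of_int n)\<^sup>2"
proof
  assume "w\<^sup>2 = (of_real pi * of_int n)\<^sup>2"
  then have "w = of_int n * of_real pi \<or> w = of_int (- n) * of_real pi"
    by (auto simp: power2_eq_iff mult.commute)
  then obtain k :: int where "w = of_int k * of_real pi" by blast
  then have "sin w = 0"
    by (auto simp: sin_eq_0)
  with assms show False by simp
qed

text \<open>Bridge from unordered sums over the integers, as in \<open>S_series\<close>, to ordinary
  series, which the Digamma function and termwise differentiation require. The indices
  \<open>n\<close> and \<open>- n\<close> contribute equally, and index 0 only once.\<close>

lemma has_sum_int_even:
  fixes h :: "int \<Rightarrow> complex"
  assumes even: "\<And>n. h (- n) = h n" and summable: "summable (\<lambda>n. norm (h (int n)))"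
  shows "(h has_sum (\<Sum>n. (if n = 0 then 1 else 2) * h (int n))) UNIV"
proof -
  define A where "A = (\<Sum>n. h (int n))"
  have sA: "(\<lambda>n. h (int n)) sums A"
    unfolding A_def by (rule summable_sums[OF summable_norm_cancel[OF summable]])
  have "((\<lambda>n. h (int n)) has_sum A) UNIV"
    using summable sA by (rule norm_summable_imp_has_sum)
  also have "?this \<longleftrightarrow> (h has_sum A) {0..}"
    by (rule has_sum_reindex_bij_witness[of _ nat int]) auto
  finally have 1: "(h has_sum A) {0..}" .
  have "(\<lambda>n. h (int (Suc n))) sums (A - h 0)"
    using sA by (subst sums_Suc_iff) auto
  moreover have "summable (\<lambda>n. norm (h (int (Suc n))))"
    using summable by (subst summable_Suc_iff)
  ultimately have "((\<lambda>n. h (int (Suc n))) has_sum (A - h 0)) UNIV"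
    by (intro norm_summable_imp_has_sum)
  also have "?this \<longleftrightarrow> (h has_sum (A - h 0)) {..<0}"
    by (rule has_sum_reindex_bij_witness[of _ "\<lambda>n. nat (- n - 1)" "\<lambda>n. - int (Suc n)"])
       (auto simp: even simp del: of_nat_Suc)
  finally have "(h has_sum (A + (A - h 0))) ({0..} \<union> {..<0})"
    by (intro has_sum_Un_disjoint 1) auto
  also have "{0..} \<union> {..<0} = (UNIV :: int set)"
    by auto
  finally have 2: "(h has_sum (A + (A - h 0))) UNIV" .
  have "(\<lambda>n. h (int n) + (h (int n) - (if n = 0 then h (int n) else 0))) sums (A + (A - h (int 0)))"
    by (intro sums_add sums_diff sA sums_single)
  also have "(\<lambda>n. h (int n) + (h (int n) - (if n = 0 then h (int n) else 0))) =
      (\<lambda>n. (if n = 0 then 1 else 2) * h (int n))"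
    by auto
  finally show ?thesis
    using 2 by (simp add: sums_iff)
qed

text \<open>Half of \<open>1 / (w - pi * n) + 1 / (w + pi * n)\<close>. Up to sign and a power of 2,
  its \<open>k\<close>-th power is the summand of \<open>S_series k\<close>.\<close>

definition pole_term :: "int \<Rightarrow> complex \<Rightarrow> complex" where
  "pole_term n w = w / (w\<^sup>2 - (of_real pi * of_int n)\<^sup>2)"

lemma pole_term_minus: "pole_term (- n) w = pole_term n w"
  by (simp add: pole_term_def)

text \<open>As \<open>pi > 3\<close>, the square of \<open>pi * n\<close> is at least
  \<open>9 * n^2\<close>, while \<open>w^2\<close> takes away at most \<open>n^2\<close>.\<close>

lemma norm_pole_denominator_ge:
  fixes w :: complex
  assumes "norm w \<le> real n"
  shows "real n ^ 2 \<le> norm (w\<^sup>2 - (of_real pi * of_int (int n))\<^sup>2)"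
proof -
  have "3 * real n \<le> pi * real n"
    using pi_gt3 by (intro mult_right_mono) auto
  then have "(3 * real n)\<^sup>2 \<le> (pi * real n)\<^sup>2"
    by (intro power_mono) auto
  moreover have "(norm w)\<^sup>2 \<le> (real n)\<^sup>2"
    using assms by (intro power_mono) auto
  moreover have "norm ((of_real pi * of_int (int n))\<^sup>2 :: complex) - norm (w\<^sup>2)
      \<le> norm (w\<^sup>2 - (of_real pi * of_int (int n))\<^sup>2)"
    by (subst norm_minus_commute) (rule norm_triangle_ineq2)
  moreover have "norm ((of_real pi * of_int (int n))\<^sup>2 :: complex) = (pi * real n)\<^sup>2"
    by (simp add: norm_power norm_mult)
  moreover have "(3 * real n)\<^sup>2 = 9 * (real n)\<^sup>2" "norm (w\<^sup>2) = (norm w)\<^sup>2"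
    by (simp_all add: norm_power power_mult_distrib)
  moreover have "0 \<le> (real n)\<^sup>2" by simp
  ultimately show ?thesis
    by linarith
qed

lemma norm_pole_term_le:
  assumes "norm w \<le> R" "R \<le> real n" "n > 0"
  shows "norm (pole_term (int n) w) \<le> R / real n ^ 2"
proof -
  have "norm (pole_term (int n) w) = norm w / norm (w\<^sup>2 - (of_real pi * of_int (int n))\<^sup>2)"
    by (simp add: pole_term_def norm_divide)
  also have "\<dots> \<le> R / real n ^ 2"
    using assms norm_pole_denominator_ge[of w n] order_trans[OF norm_ge_zero assms(1)]
    by (intro frac_le) auto
  finally show ?thesis .
qed

text \<open>One factor supplies the decay \<open>1 / n^2\<close>; each of the other \<open>k\<close>
  is at most \<open>R\<close>. The bound depends on \<open>w\<close> only through \<open>R\<close>,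
  as the M-test on a disc demands.\<close>

lemma norm_pole_term_power_le:
  assumes "norm w \<le> R" "R \<le> real n" "n > 0"
  shows "norm (pole_term (int n) w ^ Suc k) \<le> R ^ Suc k / real n ^ 2"
proof -
  have R: "R \<ge> 0" using assms(1) norm_ge_zero order_trans by blast
  have n: "1 \<le> real n ^ 2" using assms(3) by simp
  have le: "norm (pole_term (int n) w) \<le> R / real n ^ 2"
    using norm_pole_term_le[OF assms] .
  also have "\<dots> \<le> R"
    using n R by (simp add: divide_le_eq mult_left_le mult_le_cancel_left1)
  finally have "norm (pole_term (int n) w) ^ k \<le> R ^ k"
    by (intro power_mono) auto
  then have "norm (pole_term (int n) w) * norm (pole_term (int n) w) ^ k \<le> R / real n ^ 2 * R ^ k"
    using le R by (intro mult_mono) auto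
  then show ?thesis by (simp add: norm_power norm_mult)
qed

lemma summable_inverse_squares_mult: "summable (\<lambda>n. C / real n ^ 2)"
  using summable_mult[OF inverse_power_summable[of 2, where ?'a = real], of C]
  by (simp add: field_simps)

lemma summable_norm_pole_term_power: "summable (\<lambda>n. norm (pole_term (int n) w ^ Suc k))"
proof (rule summable_comparison_test_ev)
  show "eventually (\<lambda>n. norm (norm (pole_term (int n) w ^ Suc k)) \<le> norm w ^ Suc k / real n ^ 2)
      sequentially"
    using eventually_gt_at_top[of 0] eventually_ge_at_top[of "nat \<lceil>norm w\<rceil>"]
  proof eventually_elim
    case (elim n)
    then show ?case
      using norm_pole_term_power_le[of w "norm w" n k] by (simp add: nat_ceiling_le_eq del: power_Suc)
  qed
qed (rule summable_inverse_squares_mult)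

section \<open>Partial fractions of the cotangent and the cosecant\<close>

text \<open>Differentiate the reflection formula:
  \<open>Gamma z * Gamma (1 - z) * sin (pi * z)\<close> is constantly \<open>pi\<close>, so its
  derivative vanishes, and the nonzero Gamma factors can be cancelled.\<close>

lemma Digamma_reflection:
  fixes z :: complex
  assumes "sin (of_real pi * z) \<noteq> 0"
  shows "Digamma (1 - z) - Digamma z = of_real pi * cot (of_real pi * z)"
proof -
  let ?U = "{z::complex. sin (of_real pi * z) \<noteq> 0}"
  have "open ?U" by (intro open_Collect_neq continuous_intros)
  have zU: "z \<in> ?U" using assms by simp
  have z: "z \<notin> \<int>"
  proof
    assume "z \<in> \<int>"
    then show False using assms by (auto elim!: Ints_cases simp: sin_eq_0 mult.commute)
  qed
  then have np: "z \<notin> \<int>\<^sub>\<le>\<^sub>0" "1 - z \<notin> \<int>\<^sub>\<le>\<^sub>0"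
    using nonpos_Ints_subset_Ints minus_in_Ints_iff[of "1 - z"] Ints_add[of "z - 1" 1] by auto
  let ?F = "\<lambda>z. Gamma z * Gamma (1 - z) * sin (of_real pi * z)"
  let ?D = "Gamma z * Gamma (1 - z) * ((Digamma z - Digamma (1 - z)) * sin (of_real pi * z)
      + of_real pi * cos (of_real pi * z))"
  have "(?F has_field_derivative ?D) (at z)"
    using np by (auto intro!: derivative_eq_intros simp: algebra_simps)
  moreover have "(?F has_field_derivative 0) (at z)"
    by (rule has_field_derivative_transform_within_open[OF DERIV_const \<open>open ?U\<close> zU])
       (simp add: Gamma_reflection_complex)
  ultimately have "?D = 0" by (rule DERIV_unique)
  moreover have "Gamma z * Gamma (1 - z) \<noteq> 0"
    using assms by (simp add: Gamma_reflection_complex)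
  ultimately have "(Digamma z - Digamma (1 - z)) * sin (of_real pi * z)
      + of_real pi * cos (of_real pi * z) = 0"
    by simp
  then have "(Digamma (1 - z) - Digamma z) * sin (of_real pi * z) = of_real pi * cos (of_real pi * z)"
    by (simp add: algebra_simps add_eq_0_iff)
  then show ?thesis
    using assms by (simp add: cot_def divide_simps mult.commute)
qed

lemma has_sum_cot:
  assumes w: "sin w \<noteq> 0"
  shows "((\<lambda>n. pole_term n w) has_sum cot w) UNIV"
proof -
  define z where "z = w / of_real pi"
  have wz: "w = of_real pi * z" by (simp add: z_def)
  have neq: "z\<^sup>2 \<noteq> (of_int n)\<^sup>2" for n
    using square_neq_pole[OF w, of n] by (auto simp: wz power_mult_distrib)
  have z0: "z \<noteq> 0" using w by (auto simp: wz)
  have nz: "1 + z \<noteq> 0" "1 - z \<noteq> 0"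
  proof -
    have "(1 + z) * (1 - z) \<noteq> 0"
      using neq[of 1] by (simp add: algebra_simps power2_eq_square)
    then show "1 + z \<noteq> 0" "1 - z \<noteq> 0" by auto
  qed
  \<comment> \<open>In the difference of the two Digamma series the convergence-producing terms and
    the Euler constants cancel. Taking \<open>1 + z\<close> instead of \<open>z\<close> pairs the
    poles of indices \<open>n + 1\<close> and \<open>- (n + 1)\<close>; index 0 is left over as
    \<open>1 / z\<close>.\<close>
  have "(\<lambda>n. (inverse (of_nat (Suc n)) - inverse ((1 - z) + of_nat n))
      - (inverse (of_nat (Suc n)) - inverse ((1 + z) + of_nat n))) sums
      ((Digamma (1 - z) + euler_mascheroni) - (Digamma (1 + z) + euler_mascheroni))"
    unfolding Digamma_def by (simp only: diff_add_cancel)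
      (intro sums_diff summable_sums summable_Digamma nz)
  moreover have "Digamma (1 + z) = Digamma z + 1 / z"
    using Digamma_plus1[OF z0] by (simp add: add.commute)
  ultimately have "(\<lambda>n. inverse (1 + z + of_nat n) - inverse (1 - z + of_nat n)) sums
      (of_real pi * cot w - 1 / z)"
    using Digamma_reflection[of z] w by (simp add: wz algebra_simps)
  also have "(\<lambda>n. inverse (1 + z + of_nat n) - inverse (1 - z + of_nat n)) =
      (\<lambda>n. of_real pi * (2 * pole_term (int (Suc n)) w))"
  proof
    fix n
    have a: "z\<^sup>2 \<noteq> (1 + of_nat n)\<^sup>2"
      using neq[of "int (Suc n)"] by simp
    define u v where "u = 1 + z + of_nat n" and "v = 1 - z + of_nat n"
    have uv: "u * v = - (z\<^sup>2 - (1 + of_nat n)\<^sup>2)" "v - u = - (2 * z)"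
      by (simp_all add: u_def v_def algebra_simps power2_eq_square)
    with a have "u \<noteq> 0" "v \<noteq> 0"
      by auto
    then have "inverse u - inverse v = (v - u) / (u * v)"
      by (simp add: divide_simps)
    then have "inverse (1 + z + of_nat n) - inverse (1 - z + of_nat n) = 2 * z / (z\<^sup>2 - (1 + of_nat n)\<^sup>2)"
      unfolding uv minus_divide_divide by (simp only: u_def v_def)
    also have "\<dots> = of_real pi * (2 * pole_term (int (Suc n)) w)"
      by (simp add: pole_term_def wz power_mult_distrib flip: right_diff_distrib)
         (simp add: power2_eq_square divide_simps)
    finally show "inverse (1 + z + of_nat n) - inverse (1 - z + of_nat n) =
      of_real pi * (2 * pole_term (int (Suc n)) w)" .
  qed
  finally have "(\<lambda>n. (1 / of_real pi) * (of_real pi * (2 * pole_term (int (Suc n)) w))) sums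
      ((1 / of_real pi) * (of_real pi * cot w - 1 / z))"
    by (rule sums_mult)
  moreover have "(1 / of_real pi) * (of_real pi * cot w - 1 / z) = cot w - pole_term 0 w"
    using z0 by (simp add: pole_term_def wz field_simps power2_eq_square)
  ultimately have "(\<lambda>n. (if Suc n = 0 then 1 else 2) * pole_term (int (Suc n)) w) sums (cot w - pole_term 0 w)"
    by simp
  then have "(\<lambda>n. (if n = 0 then 1 else 2) * pole_term (int n) w) sums cot w"
    by (subst (asm) sums_Suc_iff) simp
  moreover have "((\<lambda>n. pole_term n w) has_sum
      (\<Sum>n. (if n = 0 then 1 else 2) * pole_term (int n) w)) UNIV"
    using summable_norm_pole_term_power[of w 0]
    by (intro has_sum_int_even) (simp_all add: pole_term_minus)
  ultimately show ?thesis
    by (simp add: sums_iff)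
qed

text \<open>Since \<open>csc w = cot (w / 2) - cot w\<close> and the first cotangent only has the poles with even
  index, the alternating signs appear.\<close>

lemma has_sum_csc:
  assumes w: "sin w \<noteq> 0"
  shows "((\<lambda>n. (-1) powi n * pole_term n w) has_sum csc w) UNIV"
proof -
  have sin_w: "sin w = 2 * sin (w / 2) * cos (w / 2)"
    using sin_double[of "w / 2"] by simp
  have cos_w: "cos w = 2 * cos (w / 2) ^ 2 - 1"
    using cos_double_cos[of "w / 2"] by simp
  have nz: "sin (w / 2) \<noteq> 0" "cos (w / 2) \<noteq> 0"
    using w by (auto simp: sin_w)
  have "((\<lambda>n. pole_term n (w / 2)) has_sum cot (w / 2)) UNIV"
    by (rule has_sum_cot[OF nz(1)])
  \<comment> \<open>Doubling the argument moves the poles to the even multiples of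
    \<open>pi\<close>.\<close>
  also have "(\<lambda>n. pole_term n (w / 2)) = (\<lambda>n. 2 * pole_term (2 * n) w)"
  proof
    fix n
    have "w\<^sup>2 - (of_real pi * of_int (2 * n))\<^sup>2 = 4 * ((w / 2)\<^sup>2 - (of_real pi * of_int n)\<^sup>2)"
      by (simp add: power2_eq_square algebra_simps)
    moreover have "w / 2 / D = 2 * (w / (4 * D))" for D
      by simp
    ultimately show "pole_term n (w / 2) = 2 * pole_term (2 * n) w"
      by (simp only: pole_term_def)
  qed
  also have "((\<lambda>n. 2 * pole_term (2 * n) w) has_sum cot (w / 2)) UNIV \<longleftrightarrow>
      ((\<lambda>n. 2 * pole_term n w) has_sum cot (w / 2)) {n. even n}"
    by (rule has_sum_reindex_bij_witness[of _ "\<lambda>n. n div 2" "\<lambda>n. 2 * n"]) auto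
  also have "\<dots> \<longleftrightarrow> ((\<lambda>n. if even n then 2 * pole_term n w else 0) has_sum cot (w / 2)) UNIV"
    by (rule has_sum_cong_neutral) auto
  finally have "((\<lambda>n. (if even n then 2 * pole_term n w else 0) - pole_term n w) has_sum
      (cot (w / 2) - cot w)) UNIV"
    using has_sum_add[OF _ has_sum_uminusI] has_sum_cot[OF w] by (simp add: o_def)
  also have "(\<lambda>n. (if even n then 2 * pole_term n w else 0) - pole_term n w) =
      (\<lambda>n. (-1) powi n * pole_term n w)"
    by (auto simp: power_int_minus_left)
  also have "cot (w / 2) - cot w = csc w"
    using nz by (simp add: cot_def csc_def sin_w cos_w divide_simps) (simp add: algebra_simps power2_eq_square)
  finally show ?thesis .
qed

lemma S_series_1:
  assumes "sin w \<noteq> 0"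
  shows "S_series 1 w = csc w"
  using infsumI[OF has_sum_csc[OF assms]] by (simp add: S_series_def pole_term_def)

section \<open>The recursion for the alternating series\<close>

lemma S_series_conv_suminf:
  "S_series (Suc k) w =
     2 ^ k * (\<Sum>n. (if n = 0 then 1 else 2) * ((-1) ^ n * pole_term (int n) w ^ Suc k))"
proof -
  have "((\<lambda>n. (-1) powi n * pole_term n w ^ Suc k) has_sum
      (\<Sum>n. (if n = 0 then 1 else 2) * ((-1) powi (int n) * pole_term (int n) w ^ Suc k))) UNIV"
    using summable_norm_pole_term_power[of w k]
    by (intro has_sum_int_even)
       (auto simp: pole_term_minus power_int_minus_left norm_mult norm_power)
  then show ?thesis
    by (simp add: S_series_def infsumI pole_term_def power_divide del: power_Suc)
qed

text \<open>The derivative is a polynomial in the term itself, with coefficients depending only on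
  \<open>w\<close>; the square is what raises the exponent from \<open>k\<close> to
  \<open>k + 1\<close> in the recursion.\<close>

lemma pole_term_deriv:
  assumes "sin w \<noteq> 0"
  shows "(pole_term n has_field_derivative (pole_term n w / w - 2 * pole_term n w ^ 2)) (at w)"
proof -
  have "w\<^sup>2 \<noteq> (of_real pi * of_int n)\<^sup>2" using assms by (rule square_neq_pole)
  then have D: "w\<^sup>2 - (of_real pi * of_int n)\<^sup>2 \<noteq> 0" (is "?D \<noteq> 0")
    by simp
  have "w \<noteq> 0" using assms by auto
  have "(pole_term n has_field_derivative (1 * ?D - w * (2 * w)) / (?D * ?D)) (at w)"
    unfolding pole_term_def[abs_def]
    by (rule DERIV_divide[where f = "\<lambda>w. w" and g = "\<lambda>w. w\<^sup>2 - (of_real pi * of_int n)\<^sup>2"])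
       (use D in \<open>auto intro!: derivative_eq_intros\<close>)
  also have "(1 * D - w * (2 * w)) / (D * D) = w / D / w - 2 * (w / D)\<^sup>2" if "D \<noteq> 0" for D
    using that \<open>w \<noteq> 0\<close> by (simp add: diff_divide_distrib power2_eq_square)
  note this[OF D]
  finally show ?thesis
    by (simp only: pole_term_def[abs_def])
qed

lemma summable_pole_term_power:
  "summable (\<lambda>n. (if n = 0 then 1 else 2) * ((-1) ^ n * pole_term (int n) w ^ Suc k))"
proof (rule summable_comparison_test)
  show "\<exists>N. \<forall>n\<ge>N. norm ((if n = 0 then 1 else 2) * ((-1) ^ n * pole_term (int n) w ^ Suc k))
      \<le> 2 * norm (pole_term (int n) w ^ Suc k)"
    by (auto simp: norm_mult norm_power)
qed (intro summable_mult summable_norm_pole_term_power)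

text \<open>This is the recursion for \<open>S_series\<close> solved for the derivative. It holds
  term by term by \<open>pole_term_deriv\<close>, and the M-test on a closed disc around
  \<open>w\<close> permits differentiating under the sum.\<close>

lemma S_series_deriv:
  assumes w: "sin w \<noteq> 0"
  shows "(S_series (Suc k) has_field_derivative
     of_nat (Suc k) * (S_series (Suc k) w / w - S_series (Suc (Suc k)) w)) (at w)"
proof -
  \<comment> \<open>The weights combine the alternating sign with the multiplicity of the pair
    \<open>n\<close>, \<open>- n\<close>.\<close>
  define c :: "nat \<Rightarrow> complex" where "c = (\<lambda>n. (if n = 0 then 1 else 2) * (-1) ^ n)"
  have norm_c: "norm (c n) \<le> 2" for n
    by (simp add: c_def norm_mult norm_power)
  define a where "a = (\<lambda>j n v. c n * pole_term (int n) v ^ Suc j)"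
  have S: "S_series (Suc j) v = 2 ^ j * (\<Sum>n. a j n v)" for j v
    by (simp add: S_series_conv_suminf a_def c_def mult.assoc)
  have summable_a: "summable (\<lambda>n. a j n v)" for j v
    using summable_pole_term_power[of v j] by (simp add: a_def c_def mult.assoc)
  define a' where "a' = (\<lambda>n v. of_nat (Suc k) * (a k n v / v - 2 * a (Suc k) n v))"
  have "w \<in> {w. sin w \<noteq> 0}" using w by simp
  then obtain e where e: "e > 0" and ball: "cball w e \<subseteq> {w. sin w \<noteq> 0}"
    using open_sin_nonzero unfolding open_contains_cball by blast
  have deriv: "(a k n has_field_derivative a' n v) (at v within cball w e)" if "v \<in> cball w e" for n v
  proof -
    have "sin v \<noteq> 0" using that ball by auto
    have "(a k n has_field_derivative c n * (of_nat (Suc k) *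
        ((pole_term (int n) v / v - 2 * pole_term (int n) v ^ 2) * pole_term (int n) v ^ k))) (at v)"
      using DERIV_cmult[OF DERIV_power[OF pole_term_deriv[OF \<open>sin v \<noteq> 0\<close>, of "int n"], of "Suc k"], of "c n"]
      unfolding a_def by (simp only: diff_Suc_Suc diff_zero)
    also have "c n * (of_nat (Suc k) *
        ((pole_term (int n) v / v - 2 * pole_term (int n) v ^ 2) * pole_term (int n) v ^ k)) = a' n v"
      by (simp add: a_def a'_def algebra_simps power2_eq_square)
    finally show ?thesis
      by (rule has_field_derivative_at_within)
  qed
  \<comment> \<open>\<open>R\<close> and \<open>m\<close> bound \<open>norm v\<close> from above and
    below on the disc. The lower bound controls the division by \<open>v\<close> in
    \<open>a'\<close>; it is positive because 0, a zero of the sine, lies outside the disc.\<close>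
  define R where "R = norm w + e"
  define m where "m = norm w - e"
  have "0 \<notin> cball w e" using subsetD[OF ball, of 0] by fastforce
  then have m: "m > 0" by (simp add: m_def)
  have m_le: "m \<le> norm v" if "v \<in> cball w e" for v
    using that norm_triangle_sub[of w v] by (simp add: m_def dist_norm)
  have R: "norm v \<le> R" if "v \<in> cball w e" for v
    using that norm_triangle_sub[of v w] by (simp add: R_def dist_norm norm_minus_commute)
  define M where "M = real (Suc k) * (2 * R ^ Suc k / m + 2 * (2 * R ^ Suc (Suc k)))"
  have bound: "norm (a' n v) \<le> M / real n ^ 2" if n: "R \<le> real n" "n > 0" and v: "v \<in> cball w e" for n v
  proof -
    have *: "norm (a j n v) \<le> 2 * R ^ Suc j / real n ^ 2" for j
    proof -
      have "norm (a j n v) \<le> 2 * (R ^ Suc j / real n ^ 2)"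
        unfolding a_def norm_mult
        by (intro mult_mono norm_c norm_pole_term_power_le R v n) auto
      then show ?thesis by simp
    qed
    have "norm (a k n v / v) = norm (a k n v) / norm v" by (rule norm_divide)
    also have "\<dots> \<le> (2 * R ^ Suc k / real n ^ 2) / m"
      by (rule frac_le[OF order_trans[OF norm_ge_zero *] * m m_le[OF v]])
    finally have "norm (a k n v / v - 2 * a (Suc k) n v)
        \<le> (2 * R ^ Suc k / real n ^ 2) / m + 2 * (2 * R ^ Suc (Suc k) / real n ^ 2)"
      using *[of "Suc k"] by (intro order_trans[OF norm_triangle_ineq4] add_mono) (auto simp: norm_mult)
    then have "norm (a' n v) \<le> real (Suc k) *
        ((2 * R ^ Suc k / real n ^ 2) / m + 2 * (2 * R ^ Suc (Suc k) / real n ^ 2))"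
      unfolding a'_def norm_mult norm_of_nat by (intro mult_left_mono) auto
    also have "\<dots> = M / real n ^ 2"
      by (simp add: M_def add_divide_distrib algebra_simps)
    finally show ?thesis .
  qed
  have "uniformly_convergent_on (cball w e) (\<lambda>n v. \<Sum>i<n. a' i v)"
  proof (rule Weierstrass_m_test'_ev)
    show "eventually (\<lambda>n. \<forall>v\<in>cball w e. norm (a' n v) \<le> M / real n ^ 2) sequentially"
      using eventually_gt_at_top[of 0] eventually_ge_at_top[of "nat \<lceil>R\<rceil>"]
      by eventually_elim (auto intro!: bound simp: nat_ceiling_le_eq)
  qed (rule summable_inverse_squares_mult)
  then have "((\<lambda>v. \<Sum>n. a k n v) has_field_derivative (\<Sum>n. a' n w)) (at w)"
    using deriv e summable_a
    by (intro has_field_derivative_series'(2)[of "cball w e" "a k" a' w]) auto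
  then have "(S_series (Suc k) has_field_derivative 2 ^ k * (\<Sum>n. a' n w)) (at w)"
    unfolding S by (rule DERIV_cmult)
  moreover have "(\<Sum>n. a' n w) = of_nat (Suc k) * ((\<Sum>n. a k n w) / w - 2 * (\<Sum>n. a (Suc k) n w))"
    unfolding a'_def
    by (intro sums_unique[symmetric] sums_mult sums_diff sums_divide summable_sums summable_a)
  \<comment> \<open>The factor 2 in front of the second sum turns \<open>2 ^ k\<close> into the
    \<open>2 ^ Suc k\<close> of the next series.\<close>
  ultimately show ?thesis
    by (simp add: S algebra_simps)
qed

section \<open>The trigonometric expansion\<close>

lemma b_trig_eq_0: "p > q \<Longrightarrow> b_trig p q w = 0"
  by (cases q) auto

text \<open>Ensures that each \<open>deriv\<close> in the recursion is a genuine derivative.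
  Holomorphy, unlike mere differentiability, passes directly to the derivative, so the induction
  closes.\<close>

lemma b_trig_holomorphic: "b_trig p q holomorphic_on {w. sin w \<noteq> 0}"
proof (induction q arbitrary: p)
  case 0
  then show ?case by (simp add: fun_eq_iff)
next
  case (Suc q)
  have "cot holomorphic_on {w::complex. sin w \<noteq> 0}"
    by (auto intro!: holomorphic_intros simp: cot_def[abs_def])
  moreover have "deriv (b_trig p q) holomorphic_on {w. sin w \<noteq> 0}"
    by (intro holomorphic_deriv Suc.IH open_sin_nonzero)
  ultimately have "(\<lambda>w. cot w * b_trig p q w - deriv (b_trig p q) w
      + (if p = 0 then 0 else of_nat (p + q) * b_trig (p - 1) q w)) holomorphic_on {w. sin w \<noteq> 0}"
    using Suc.IH by (cases "p = 0") (auto intro!: holomorphic_intros)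
  then show ?case
    by (cases "p \<le> Suc q") simp_all
qed

lemma b_trig_deriv:
  assumes "sin w \<noteq> 0"
  shows "(b_trig p q has_field_derivative deriv (b_trig p q) w) (at w)"
  using holomorphic_derivI[OF b_trig_holomorphic open_sin_nonzero] assms by simp

lemma sum_b_trig_Suc:
  assumes "w \<noteq> 0"
  shows "(\<Sum>p\<le>Suc q. b_trig p (Suc q) w / w ^ p) =
    (\<Sum>p\<le>q. (cot w * b_trig p q w - deriv (b_trig p q) w) / w ^ p
           + of_nat (Suc (p + q)) * b_trig p q w / w ^ Suc p)"
proof -
  let ?A = "\<lambda>p. (cot w * b_trig p q w - deriv (b_trig p q) w) / w ^ p"
  let ?B = "\<lambda>p. (if p = 0 then 0 else of_nat (p + q) * b_trig (p - 1) q w) / w ^ p"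
  \<comment> \<open>Equality as functions is needed, so that the derivative vanishes too.\<close>
  have "b_trig (Suc q) q = (\<lambda>_. 0)"
    by (simp add: fun_eq_iff b_trig_eq_0)
  then have A: "?A (Suc q) = 0"
    by simp
  have "(\<Sum>p\<le>Suc q. b_trig p (Suc q) w / w ^ p) = (\<Sum>p\<le>Suc q. ?A p + ?B p)"
    by (intro sum.cong) (auto simp: add_divide_distrib)
  also have "\<dots> = (\<Sum>p\<le>Suc q. ?A p) + (\<Sum>p\<le>Suc q. ?B p)"
    by (rule sum.distrib)
  also have "(\<Sum>p\<le>Suc q. ?A p) = (\<Sum>p\<le>q. ?A p)"
    using A by simp
  \<comment> \<open>Shifting \<open>p\<close> by one turns the factor \<open>p + q\<close> into
    \<open>Suc (p + q)\<close>.\<close>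
  also have "(\<Sum>p\<le>Suc q. ?B p) = (\<Sum>p\<le>q. of_nat (Suc (p + q)) * b_trig p q w / w ^ Suc p)"
    by (subst sum.atMost_Suc_shift) simp
  finally show ?thesis
    by (simp add: sum.distrib)
qed

text \<open>Induction with \<open>w\<close> arbitrary: the formula for \<open>q\<close> must hold on
  an open set before it can be differentiated.\<close>

lemma S_series_b_trig:
  assumes "sin w \<noteq> 0"
  shows "S_series (Suc q) w = csc w / fact q * (\<Sum>p\<le>q. b_trig p q w / w ^ p)"
  using assms
proof (induction q arbitrary: w)
  case 0
  then show ?case using S_series_1[of w] by simp
next
  case (Suc q)
  have w: "w \<noteq> 0" using Suc.prems by auto
  let ?E = "\<lambda>w. csc w / fact q * (\<Sum>p\<le>q. b_trig p q w / w ^ p)"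
  have csc: "(csc has_field_derivative (- csc w * cot w)) (at w)"
    unfolding csc_def[abs_def] cot_def using Suc.prems
    by (auto intro!: derivative_eq_intros simp: divide_simps power2_eq_square)
  have summand: "((\<lambda>w. b_trig p q w / w ^ p) has_field_derivative
      (deriv (b_trig p q) w / w ^ p - of_nat p * b_trig p q w / w ^ Suc p)) (at w)" for p
  proof (rule DERIV_cong[OF DERIV_divide[OF b_trig_deriv[OF Suc.prems] DERIV_power[OF DERIV_ident, of p]]])
    show "w ^ p \<noteq> 0" using w by simp
    show "(deriv (b_trig p q) w * w ^ p - b_trig p q w * (of_nat p * (1 * w ^ (p - Suc 0)))) / (w ^ p * w ^ p)
        = deriv (b_trig p q) w / w ^ p - of_nat p * b_trig p q w / w ^ Suc p"
      using w by (cases p) (simp_all add: diff_divide_distrib mult.commute)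
  qed
  have "(?E has_field_derivative (- csc w * cot w) / fact q * (\<Sum>p\<le>q. b_trig p q w / w ^ p)
      + csc w / fact q * (\<Sum>p\<le>q. deriv (b_trig p q) w / w ^ p - of_nat p * b_trig p q w / w ^ Suc p)) (at w)"
    (is "(_ has_field_derivative ?E') _")
    by (rule DERIV_cong[OF DERIV_mult[OF DERIV_cdivide[OF csc] DERIV_sum[OF summand]]]) (simp add: mult.commute)
  \<comment> \<open>Near \<open>w\<close> the induction hypothesis identifies \<open>?E\<close> with
    the series, so the two derivatives agree and can be solved for the next series.\<close>
  moreover have "(?E has_field_derivative
      of_nat (Suc q) * (S_series (Suc q) w / w - S_series (Suc (Suc q)) w)) (at w)"
    by (rule has_field_derivative_transform_within_open[OF S_series_deriv open_sin_nonzero])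
       (use Suc in auto)
  ultimately have "?E' = of_nat (Suc q) * (S_series (Suc q) w / w - S_series (Suc (Suc q)) w)"
    by (rule DERIV_unique)
  then have "S_series (Suc (Suc q)) w = ?E w / w - ?E' / of_nat (Suc q)"
    using Suc by (simp del: of_nat_Suc)
  also have "\<dots> = csc w / fact (Suc q) * (of_nat (Suc q) / w * (\<Sum>p\<le>q. b_trig p q w / w ^ p)
      + cot w * (\<Sum>p\<le>q. b_trig p q w / w ^ p)
      - (\<Sum>p\<le>q. deriv (b_trig p q) w / w ^ p - of_nat p * b_trig p q w / w ^ Suc p))"
    using w by (simp add: field_simps del: of_nat_Suc)
  \<comment> \<open>At \<open>1 / w ^ Suc p\<close> the factor \<open>Suc q\<close> from the
    division by \<open>w\<close> and the \<open>p\<close> from differentiating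
    \<open>1 / w ^ p\<close> add up to \<open>Suc (p + q)\<close>.\<close>
  also have "\<dots> = csc w / fact (Suc q) * (\<Sum>p\<le>Suc q. b_trig p (Suc q) w / w ^ p)"
    unfolding sum_b_trig_Suc[OF w] sum_distrib_left sum.distrib[symmetric] sum_subtractf[symmetric]
    using w by (intro arg_cong2[of _ _ _ _ "(*)"] refl sum.cong) (simp add: field_simps)
  finally show ?case .
qed

section \<open>Collecting powers of \<open>1 / w\<close>\<close>

lemma B_term_expansion:
  assumes "sin w \<noteq> 0"
  shows "B_term r w = csc w * (\<Sum>k\<le>2*r. d_coeff r k w / w ^ k)"
proof -
  let ?g = "\<lambda>j p. (-2) ^ j * of_real (alpha j r) / fact (2 * r - j) * b_trig p (2 * r - j) w / w ^ (j + p)"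
  have w: "w \<noteq> 0" using assms by auto
  have "B_term r w = (\<Sum>j\<le>2*r. csc w * (\<Sum>p\<le>2*r-j. ?g j p))"
    unfolding B_term_def atLeast0AtMost
  proof (rule sum.cong)
    fix j assume j: "j \<in> {..2*r}"
    have "2 * r + 1 - j = Suc (2 * r - j)" using j by auto
    then have "(-1) ^ j * of_real (alpha j r) * (S_series (2 * r + 1 - j) w / (w / 2) ^ j) =
        (-2) ^ j * of_real (alpha j r) / w ^ j * (csc w / fact (2 * r - j) *
          (\<Sum>p\<le>2*r-j. b_trig p (2 * r - j) w / w ^ p))"
      by (simp add: S_series_b_trig[OF assms] power_divide power_minus[of 2] mult_ac)
    also have "\<dots> = csc w * (\<Sum>p\<le>2*r-j. ?g j p)"
      unfolding sum_distrib_left by (intro sum.cong) (simp_all add: power_add mult_ac)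
    finally show "(-1) ^ j * of_real (alpha j r) * (S_series (2 * r + 1 - j) w / (w / 2) ^ j) =
        csc w * (\<Sum>p\<le>2*r-j. ?g j p)" .
  qed simp
  also have "\<dots> = csc w * (\<Sum>j\<le>2*r. \<Sum>p\<le>2*r-j. ?g j p)"
    by (simp add: sum_distrib_left)
  \<comment> \<open>The triangle \<open>j + p \<le> 2 * r\<close> is regrouped along the diagonals
    \<open>k = j + p\<close>, on which the power of \<open>w\<close> is constant.\<close>
  also have "(\<Sum>j\<le>2*r. \<Sum>p\<le>2*r-j. ?g j p) = (\<Sum>(k, p)\<in>(SIGMA k:{..2*r}. {..k}). ?g (k - p) p)"
    unfolding sum.Sigma[OF finite_atMost ballI[OF finite_atMost]]
    by (rule sum.reindex_bij_witness[of _ "\<lambda>(k, p). (k - p, p)" "\<lambda>(j, p). (j + p, p)"]) auto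
  also have "\<dots> = (\<Sum>k\<le>2*r. \<Sum>p\<le>k. ?g (k - p) p)"
    by (rule sum.Sigma[symmetric]) auto
  also have "\<dots> = (\<Sum>k\<le>2*r. d_coeff r k w / w ^ k)"
  proof (rule sum.cong)
    fix k assume k: "k \<in> {..2*r}"
    \<comment> \<open>The subtractions are on naturals; \<open>p \<le> k \<le> 2 * r\<close> keeps
      them from truncating.\<close>
    have "2 * r - (k - p) = 2 * r - k + p" if "p \<le> k" for p
      using k that by auto
    then show "(\<Sum>p\<le>k. ?g (k - p) p) = d_coeff r k w / w ^ k"
      by (simp add: d_coeff_def atLeast0AtMost sum_divide_distrib)
  qed simp
  finally show ?thesis .
qed

text \<open>Exchange of summation: for fixed \<open>k\<close>, the condition
  \<open>k \<le> 2 * r\<close> says that \<open>r\<close> is at least the ceiling of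
  \<open>k / 2\<close>.\<close>

lemma T_corr_expansion:
  assumes "sin w \<noteq> 0"
  shows "T_corr m w = csc w * (\<Sum>k=0..2*m-2. D_coeff k m w / w ^ k)"
proof -
  let ?c = "\<lambda>r. (of_real pi * \<i> / 4) ^ r :: complex"
  let ?f = "\<lambda>r k. ?c r * d_coeff r k w / w ^ k"
  have "T_corr m w = csc w * (\<Sum>r<m. \<Sum>k\<le>2*r. ?f r k)"
    by (simp add: T_corr_def B_term_expansion[OF assms] sum_distrib_left mult_ac)
  also have "(\<Sum>r<m. \<Sum>k\<le>2*r. ?f r k) =
      (\<Sum>k\<le>2*m-2. \<Sum>r\<in>{nat \<lceil>real k / 2\<rceil>..<m}. ?f r k)"
    unfolding sum.Sigma[OF finite_lessThan ballI[OF finite_atMost]]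
      sum.Sigma[OF finite_atMost ballI[OF finite_atLeastLessThan]]
    by (rule sum.reindex_bij_witness[of _ "\<lambda>(k, r). (r, k)" "\<lambda>(r, k). (k, r)"])
       (auto simp: nat_ceiling_le_eq)
  also have "\<dots> = (\<Sum>k=0..2*m-2. D_coeff k m w / w ^ k)"
    by (simp add: D_coeff_def sum_divide_distrib atLeast0AtMost)
  finally show ?thesis .
qed

theorem theorem2:
  fixes t :: real and s w :: complex and m :: nat
  assumes "t > 0"
    and "s = 1 / 2 + \<i> * of_real t"
    and "w\<^sup>2 = of_real pi * s / (2 * \<i>)"
    and "Re w > 0"
    and "m \<ge> 1"
  shows "T_corr m w = csc w * (\<Sum>k=0..2*m-2. D_coeff k m w / w ^ k)"
proof (rule T_corr_expansion)
  \<comment> \<open>Explicitly, \<open>w^2 = pi * t / 2 - \<i> * pi / 4\<close>; a real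
    \<open>w\<close> would have a real square, and all zeros of the sine are real.\<close>
  have "Im (w\<^sup>2) = - pi / 4"
    unfolding assms(2,3) by (simp add: Im_divide power2_eq_square)
  then have "Im w \<noteq> 0" by (auto simp: power2_eq_square)
  show "sin w \<noteq> 0"
  proof
    assume "sin w = 0"
    then obtain n :: int where "w = of_int n * of_real pi" by (auto simp: sin_eq_0)
    with \<open>Im w \<noteq> 0\<close> show False by simp
  qed
qed

end
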